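(* For every nonnegative integer $n$, the following hold: \begin{enumerate} \item[(a$'$)] $G_0(n) = \frac{1}{2}\bigl(G(n) + H(n)\bigr)$; \item[(b$'$)] $G_1(n) = \frac{1}{2}\bigl(G(n) - H(n)\bigr)$; \item[(c$'$)] $G_2(n) = \frac{1}{2}\bigl(G(n) + (-1)^n H(n)\bigr)$; \item[(d$'$)] $G_3(n) = \frac{1}{2}\bigl(G(n) - (-1)^n H(n)\bigr)$; \item[(e$'$)] $G_4(n) = \frac{1}{2}\bigl(G(n) + (-1)^n K(n)\bigr)$; \item[(f$'$)] $G_5(n) = \frac{1}{2}\bigl(G(n) - (-1)^n K(n)\bigr)$. \end{enumerate}
   Context: A two-color partition of $n$ is a partition of $n$ in which each part is colored either blue or green; parts of the same size but different colors are regarded as different, and parts of either color may repeat. Let $G(n)$ be the number of two-color partitions of $n$ in which odd parts may occur only in the blue color (even parts may be blue or green). Among the partitions counted by $G(n)$: $G_0(n)$ (resp. $G_1(n)$) is the number in which the number of blue even parts is even (resp. odd); $G_2(n)$ (resp. $G_3(n)$) is the number in which the number of blue parts is even (resp. odd); $G_4(n)$ (resp. $G_5(n)$) is the number in which the total number of parts is even (resp. odd). Let $H(n)$ be the number of (ordinary) partitions of $n$ in which the odd parts are distinct. Let $K(n)$ be the signed count $K(n)=\sum_\lambda (-1)^{j(\lambda)}$, where $\lambda$ ranges over partitions of $n$ into distinct parts in which every even part is congruent to $2$ modulo $4$, and $j(\lambda)$ is the number of even parts of $\lambda$; equivalently $\sum_{n\ge0}K(n)q^n=(q^2;q^4)_\infty(-q;q^2)_\infty$,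 where $(a;q)_\infty=\prod_{k\ge0}(1-aq^k)$. *)

theory Defs
  imports Complex_Main "HOL-Library.Multiset"
begin

datatype colour = Blue | Green

text \<open>
  A partition is the multiset of its parts; a part of a two-colour partition is a pair of its
  size and its colour. Hence order is irrelevant, repetition is allowed, and equal sizes in
  different colours are different parts.
\<close>

definition partitions :: "nat \<Rightarrow> nat multiset set" where
  "partitions n = {P. (\<forall>k \<in># P. 0 < k) \<and> (\<Sum>k \<in># P. k) = n}"

definition two_colour_partitions :: "nat \<Rightarrow> (nat \<times> colour) multiset set" where
  "two_colour_partitions n = {P. (\<forall>p \<in># P. 0 < fst p) \<and> (\<Sum>p \<in># P. fst p) = n}"

definition G_partitions :: "nat \<Rightarrow> (nat \<times> colour) multiset set" where
  "G_partitions n = {P \<in> two_colour_partitions n. \<forall>p \<in># P. odd (fst p) \<longrightarrow> snd p = Blue}"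

definition blue_parts :: "(nat \<times> colour) multiset \<Rightarrow> (nat \<times> colour) multiset" where
  "blue_parts P = {#p \<in># P. snd p = Blue#}"

definition blue_even_parts :: "(nat \<times> colour) multiset \<Rightarrow> (nat \<times> colour) multiset" where
  "blue_even_parts P = {#p \<in># P. snd p = Blue \<and> even (fst p)#}"

definition G :: "nat \<Rightarrow> nat" where
  "G n = card (G_partitions n)"

definition G0 :: "nat \<Rightarrow> nat" where
  "G0 n = card {P \<in> G_partitions n. even (size (blue_even_parts P))}"

definition G1 :: "nat \<Rightarrow> nat" where
  "G1 n = card {P \<in> G_partitions n. odd (size (blue_even_parts P))}"

definition G2 :: "nat \<Rightarrow> nat" where
  "G2 n = card {P \<in> G_partitions n. even (size (blue_parts P))}"

definition G3 :: "nat \<Rightarrow> nat" where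
  "G3 n = card {P \<in> G_partitions n. odd (size (blue_parts P))}"

definition G4 :: "nat \<Rightarrow> nat" where
  "G4 n = card {P \<in> G_partitions n. even (size P)}"

definition G5 :: "nat \<Rightarrow> nat" where
  "G5 n = card {P \<in> G_partitions n. odd (size P)}"

text \<open>``The odd parts are distinct'' constrains odd parts only; even parts may repeat.\<close>

definition H :: "nat \<Rightarrow> nat" where
  "H n = card {P \<in> partitions n. \<forall>k. odd k \<longrightarrow> count P k \<le> 1}"

definition K_partitions :: "nat \<Rightarrow> nat multiset set" where
  "K_partitions n =
    {P \<in> partitions n. (\<forall>k. count P k \<le> 1) \<and> (\<forall>k \<in># P. even k \<longrightarrow> k mod 4 = 2)}"

definition K :: "nat \<Rightarrow> int" where
  "K n = (\<Sum>P \<in> K_partitions n. (- 1) ^ size {#k \<in># P. even k#})"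

text \<open>
  The partition sets are finite, so that the cardinalities and the sum above never take the
  default value 0 for infinite sets.
\<close>

lemma finite_multisets_bounded_sum:
  fixes f :: "'a \<Rightarrow> nat"
  assumes "finite {x. f x \<le> n}"
  shows "finite {P. (\<forall>x \<in># P. 0 < f x) \<and> (\<Sum>x \<in># P. f x) = n}" (is "finite ?S")
proof (rule finite_subset)
  show "?S \<subseteq> (\<Union>m\<le>n. multisets_of_size {x. f x \<le> n} m)"
  proof
    fix P assume "P \<in> ?S"
    then have pos: "\<forall>x \<in># P. 0 < f x" and sum: "(\<Sum>x \<in># P. f x) = n" by auto
    have "size P \<le> (\<Sum>x \<in># P. f x)" using pos by (induction P) auto
    moreover have "f x \<le> n" if "x \<in># P" for x
      using multi_member_split[OF that] sum by auto
    ultimately show "P \<in> (\<Union>m\<le>n. multisets_of_size {x. f x \<le> n} m)"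
      using sum by (auto simp: multisets_of_size_def)
  qed
  show "finite (\<Union>m\<le>n. multisets_of_size {x. f x \<le> n} m)" using assms by auto
qed

lemma finite_partitions: "finite (partitions n)"
  unfolding partitions_def by (rule finite_multisets_bounded_sum) simp

lemma finite_two_colour_partitions: "finite (two_colour_partitions n)"
  unfolding two_colour_partitions_def
proof (rule finite_multisets_bounded_sum)
  have "(UNIV :: colour set) = {Blue, Green}" using colour.exhaust by auto
  then have "finite (UNIV :: colour set)" by (metis finite.emptyI finite.insertI)
  then have "finite ({..n} \<times> (UNIV :: colour set))" by simp
  then show "finite {p :: nat \<times> colour. fst p \<le> n}" by (rule rev_finite_subset) auto
qed

end

theory Submission
  imports Defs
begin

text \<open>
  A single part of size \<open>2k\<close> can be traded for two parts of size \<open>k\<close>. Performing such a trade at the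
  largest \<open>k\<close> where one is possible, in either direction, is an involution which changes the number
  of parts by one. Traded among the blue parts, it cancels all of \<open>G(n)\<close> except the partitions whose
  blue parts are odd and distinct, and these are the partitions counted by \<open>H(n)\<close>, with the even
  parts coloured green. Traded then among the even parts of the latter, it leaves those counted by
  \<open>K(n)\<close>. The remaining signs come from the number of odd parts, which has the parity of \<open>n\<close>.
\<close>

section \<open>Cancellation by trading a part for its two halves\<close>

lemma sum_sign_reversing_involution:
  fixes w :: "'a \<Rightarrow> int"
  assumes "\<And>x. x \<in> A \<Longrightarrow> \<phi> x \<in> A" "\<And>x. x \<in> A \<Longrightarrow> \<phi> (\<phi> x) = x"
    and "\<And>x. x \<in> A \<Longrightarrow> w (\<phi> x) = - w x"
  shows "sum w A = 0"
proof -
  have "sum w A = (\<Sum>x\<in>A. - w x)"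
    by (rule sum.reindex_bij_witness[of _ \<phi> \<phi>]) (auto simp: assms)
  then show ?thesis by (simp add: sum_negf)
qed

text \<open>The map \<open>c\<close> turns a size into a part, so that one construction serves both
  the blue parts of a two-colour partition and the parts of an ordinary one. The set
  \<open>B\<close> limits the sizes of the halves.\<close>

definition trade_sizes :: "(nat \<Rightarrow> 'a) \<Rightarrow> nat set \<Rightarrow> 'a multiset \<Rightarrow> nat set" where
  "trade_sizes c B P = {k \<in> B. c (2 * k) \<in># P \<or> 2 \<le> count P (c k)}"

text \<open>If both directions are open at the largest size, splitting takes precedence.\<close>

definition trade :: "(nat \<Rightarrow> 'a) \<Rightarrow> nat set \<Rightarrow> 'a multiset \<Rightarrow> 'a multiset" where
  "trade c B P = (let m = Max (trade_sizes c B P) in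
     if c (2 * m) \<in># P then P - {#c (2 * m)#} + {#c m, c m#}
     else P - {#c m, c m#} + {#c (2 * m)#})"

text \<open>This makes \<open>Max\<close> meaningful: by injectivity each entry of \<open>P\<close>
  accounts for at most two sizes.\<close>

lemma finite_trade_sizes:
  assumes "inj c"
  shows "finite (trade_sizes c B P)"
proof (rule finite_subset)
  show "trade_sizes c B P \<subseteq> c -` set_mset P \<union> (\<lambda>k. c (2 * k)) -` set_mset P"
    by (auto simp: trade_sizes_def simp flip: count_greater_zero_iff)
  have "inj (\<lambda>k. c (2 * k))" using assms by (intro injI) (auto dest: injD)
  then show "finite (c -` set_mset P \<union> (\<lambda>k. c (2 * k)) -` set_mset P)"
    using assms by (simp add: finite_vimageI)
qed

text \<open>A trade is undone by the next one because the maximum \<open>m\<close> does not move.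
  Only the counts of \<open>c m\<close> and \<open>c (2 * m)\<close> change, so the only larger size
  that could become tradable is \<open>2 * m\<close>, and \<open>c (2 * m)\<close> occurs at most
  once before and after. The two cases are a split and a merge; the last fact of each says that the
  result still admits a trade.\<close>

lemma trade_cases:
  assumes c: "inj c" and B: "0 \<notin> B" "\<forall>k\<in>B. 2 * k \<in> B"
    and ne: "trade_sizes c B P \<noteq> {}"
  obtains m Q where "m \<in> B" "P = Q + {#c (2 * m)#}" "trade c B P = Q + {#c m, c m#}"
      "trade c B (Q + {#c m, c m#}) = Q + {#c (2 * m)#}" "m \<in> trade_sizes c B (trade c B P)"
    | m Q where "m \<in> B" "P = Q + {#c m, c m#}" "trade c B P = Q + {#c (2 * m)#}"
      "trade c B (Q + {#c (2 * m)#}) = Q + {#c m, c m#}" "m \<in> trade_sizes c B (trade c B P)"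
proof -
  define m where "m = Max (trade_sizes c B P)"
  have mem: "m \<in> trade_sizes c B P"
    using finite_trade_sizes[OF c] ne unfolding m_def by (rule Max_in)
  have above: "k \<notin> trade_sizes c B P" if "k > m" for k
    using Max_ge[OF finite_trade_sizes[OF c]] that unfolding m_def by force
  have mB: "m \<in> B" "2 * m \<in> B" and m: "m > 0"
    using mem B by (auto simp: trade_sizes_def intro: gr0I)
  have inj [simp]: "c i = c j \<longleftrightarrow> i = j" for i j using c by (simp add: inj_eq)
  have double: "count P (c (2 * m)) < 2"
    using above[of "2 * m"] m mB by (simp add: trade_sizes_def)
  have sizes: "k \<in> B \<Longrightarrow> k > m \<Longrightarrow> c (2 * k) \<notin># P \<and> count P (c k) < 2" for k
    using above[of k] by (auto simp: trade_sizes_def)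
  show ?thesis
  proof (cases "c (2 * m) \<in># P")
    case True
    then obtain Q where P: "P = Q + {#c (2 * m)#}" by (metis add_mset_add_single insert_DiffM)
    \<comment> \<open>The split removes the only copy of \<open>c (2 * m)\<close>, so the return
      trade takes the merging branch.\<close>
    have count0: "count Q (c (2 * m)) = 0" using double by (simp add: P)
    then have notin: "c (2 * m) \<notin># Q" by (rule not_in_iff[THEN iffD2])
    have "Max (trade_sizes c B (Q + {#c m, c m#})) = m"
    proof (rule Max_eqI[OF finite_trade_sizes[OF c]])
      show "m \<in> trade_sizes c B (Q + {#c m, c m#})" using mB by (simp add: trade_sizes_def)
      fix k assume k: "k \<in> trade_sizes c B (Q + {#c m, c m#})"
      show "k \<le> m"
      proof (rule ccontr)
        assume "\<not> k \<le> m"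
        then show False using k sizes[of k] m
          by (auto simp: trade_sizes_def P count0 split: if_splits)
      qed
    qed
    then have "trade c B (Q + {#c m, c m#}) = Q + {#c (2 * m)#}"
      using notin m by (simp add: trade_def Let_def)
    moreover have "trade c B P = Q + {#c m, c m#}"
      using True unfolding trade_def m_def[symmetric] Let_def by (simp add: P)
    ultimately show ?thesis using mB P that(1)[of m Q] by (simp add: trade_sizes_def)
  next
    case False
    then have "2 \<le> count P (c m)" using mem by (simp add: trade_sizes_def)
    then have "{#c m, c m#} \<subseteq># P" by (auto simp: subseteq_mset_def)
    then obtain Q where P: "P = Q + {#c m, c m#}" by (metis subset_mset.diff_add)
    have notin: "c (2 * m) \<notin># Q" using False by (simp add: P)
    then have count0: "count Q (c (2 * m)) = 0" by (rule not_in_iff[THEN iffD1])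
    have "Max (trade_sizes c B (Q + {#c (2 * m)#})) = m"
    proof (rule Max_eqI[OF finite_trade_sizes[OF c]])
      show "m \<in> trade_sizes c B (Q + {#c (2 * m)#})" using mB by (simp add: trade_sizes_def)
      fix k assume k: "k \<in> trade_sizes c B (Q + {#c (2 * m)#})"
      show "k \<le> m"
      proof (rule ccontr)
        assume "\<not> k \<le> m"
        then show False using k sizes[of k] m
          by (auto simp: trade_sizes_def P count0 notin split: if_splits)
      qed
    qed
    then have "trade c B (Q + {#c (2 * m)#}) = Q + {#c m, c m#}"
      by (simp add: trade_def Let_def)
    moreover have "trade c B P = Q + {#c (2 * m)#}"
      using False unfolding trade_def m_def[symmetric] Let_def by (simp add: P)
    ultimately show ?thesis using mB P that(2)[of m Q] by (simp add: trade_sizes_def)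
  qed
qed

text \<open>The condition on \<open>X\<close> closes it under splits and merges alike, so
  \<open>trade\<close> is a sign-reversing involution on the members that admit a trade. The
  remaining sum runs over those that admit none.\<close>

lemma sum_cancel_trades:
  fixes c :: "nat \<Rightarrow> 'a" and w :: "'a multiset \<Rightarrow> int"
  assumes fin: "finite X" and c: "inj c" and B: "0 \<notin> B" "\<forall>k\<in>B. 2 * k \<in> B"
    and X: "\<And>Q k. k \<in> B \<Longrightarrow> Q + {#c (2 * k)#} \<in> X \<longleftrightarrow> Q + {#c k, c k#} \<in> X"
    and w: "\<And>Q k. k \<in> B \<Longrightarrow> w (Q + {#c (2 * k)#}) = - w (Q + {#c k, c k#})"
  shows "sum w X = sum w {P \<in> X. \<forall>k\<in>B. c (2 * k) \<notin># P \<and> count P (c k) \<le> 1}"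
proof -
  let ?A = "{P \<in> X. trade_sizes c B P \<noteq> {}}"
  have "trade c B P \<in> ?A \<and> trade c B (trade c B P) = P \<and> w (trade c B P) = - w P"
    if "P \<in> ?A" for P
  proof -
    from that have "P \<in> X" and ne: "trade_sizes c B P \<noteq> {}" by auto
    show ?thesis
    proof (cases rule: trade_cases[OF c B ne])
      case (1 m Q)
      then show ?thesis using X[of m Q] w[of m Q] \<open>P \<in> X\<close> by auto
    next
      case (2 m Q)
      then show ?thesis using X[of m Q] w[of m Q] \<open>P \<in> X\<close> by auto
    qed
  qed
  then have "sum w ?A = 0" by (intro sum_sign_reversing_involution[of _ "trade c B"]) auto
  moreover have "{P \<in> X. \<forall>k\<in>B. c (2 * k) \<notin># P \<and> count P (c k) \<le> 1} = X - ?A"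
    by (auto simp: trade_sizes_def not_le less_Suc_eq_le numeral_2_eq_2)
  ultimately show ?thesis using fin by (simp add: sum_diff)
qed

section \<open>Signed sums over two-colour partitions and over partitions with distinct odd
  parts\<close>

lemma power_minus_one_size_odd:
  "(- 1 :: int) ^ size {#x \<in># P. odd (f x)#} = (- 1) ^ (\<Sum>x \<in># P. f x)"
  by (induction P) (auto simp: power_add)

definition H_partitions :: "nat \<Rightarrow> nat multiset set" where
  "H_partitions n = {P \<in> partitions n. \<forall>k. odd k \<longrightarrow> count P k \<le> 1}"

text \<open>This is the only colouring that survives the blue trades; on the survivors, forgetting
  colours by \<open>image_mset fst\<close> inverts it.\<close>

definition parity_colouring :: "nat multiset \<Rightarrow> (nat \<times> colour) multiset" where
  "parity_colouring P = {#(k, if even k then Green else Blue). k \<in># P#}"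

lemma parity_colouring_image_fst:
  assumes "\<forall>p \<in># P. snd p = (if even (fst p) then Green else Blue)"
  shows "parity_colouring (image_mset fst P) = P"
  using assms unfolding parity_colouring_def by (induction P) auto

lemma image_fst_parity_colouring: "image_mset fst (parity_colouring P) = P"
  by (simp add: parity_colouring_def multiset.map_comp comp_def)

lemma count_parity_colouring:
  "count (parity_colouring P) (k, a) =
    (if a = (if even k then Green else Blue) then count P k else 0)"
  unfolding parity_colouring_def by (induction P) auto

lemma in_parity_colouring:
  "(k, a) \<in># parity_colouring P \<longleftrightarrow> a = (if even k then Green else Blue) \<and> k \<in># P"
  by (auto simp: parity_colouring_def)

lemma G_partitions_trade:
  assumes "0 < k"
  shows "Q + {#(2 * k, Blue)#} \<in> G_partitions n \<longleftrightarrow>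
    Q + {#(k, Blue), (k, Blue)#} \<in> G_partitions n"
  using assms by (auto simp: G_partitions_def two_colour_partitions_def)

lemma finite_G_partitions: "finite (G_partitions n)"
  using finite_two_colour_partitions by (simp add: G_partitions_def)

text \<open>Leaving \<open>w\<close> arbitrary lets three different statistics share one
  cancellation. Survivors of the blue trades have green even parts, which may repeat, and distinct
  blue odd parts.\<close>

lemma sum_G_partitions:
  fixes w :: "(nat \<times> colour) multiset \<Rightarrow> int"
  assumes w: "\<And>Q k. 0 < k \<Longrightarrow>
    w (Q + {#(2 * k, Blue)#}) = - w (Q + {#(k, Blue), (k, Blue)#})"
  shows "sum w (G_partitions n) = (\<Sum>P\<in>H_partitions n. w (parity_colouring P))"
proof -
  let ?F = "{P \<in> G_partitions n. \<forall>k\<in>{0<..}. (2 * k, Blue) \<notin># P \<and> count P (k, Blue) \<le> 1}"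
  have colours: "\<forall>p \<in># P. snd p = (if even (fst p) then Green else Blue)" if P: "P \<in> ?F" for P
  proof
    fix p assume p: "p \<in># P"
    \<comment> \<open>A blue even part would be twice a positive size and could be split.\<close>
    have "snd p = Green" if "even (fst p)"
    proof (rule ccontr)
      assume "snd p \<noteq> Green"
      then have "snd p = Blue" by (cases "snd p") auto
      moreover have "0 < fst p" using P p by (auto simp: G_partitions_def two_colour_partitions_def)
      ultimately show False using P p that by (cases p) (auto elim!: evenE)
    qed
    then show "snd p = (if even (fst p) then Green else Blue)"
      using P p by (auto simp: G_partitions_def)
  qed
  have "sum w (G_partitions n) = sum w ?F"
    using w by (intro sum_cancel_trades finite_G_partitions) (auto simp: inj_def G_partitions_trade[simplified])
  also have "\<dots> = (\<Sum>P\<in>H_partitions n. w (parity_colouring P))"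
  proof (rule sum.reindex_bij_witness[of _ parity_colouring "image_mset fst"])
    fix P assume P: "P \<in> ?F"
    note eq = parity_colouring_image_fst[OF colours[OF P]]
    show "parity_colouring (image_mset fst P) = P" by (rule eq)
    then show "w (parity_colouring (image_mset fst P)) = w P" by simp
    \<comment> \<open>An odd size occurs only in blue, so forgetting colours does not increase its
      multiplicity.\<close>
    have "count (image_mset fst P) k \<le> 1" if "odd k" for k
    proof -
      have "count (image_mset fst P) k = count P (k, Blue)"
        using that count_parity_colouring[of "image_mset fst P" k Blue] by (simp add: eq)
      then show ?thesis using P that by (auto simp: odd_pos)
    qed
    then show "image_mset fst P \<in> H_partitions n"
      using P by (auto simp: H_partitions_def partitions_def G_partitions_def two_colour_partitions_def)
  next
    fix P assume P: "P \<in> H_partitions n"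
    show "image_mset fst (parity_colouring P) = P" by (rule image_fst_parity_colouring)
    have "parity_colouring P \<in> G_partitions n"
      using P by (auto simp: H_partitions_def partitions_def G_partitions_def
          two_colour_partitions_def parity_colouring_def multiset.map_comp comp_def)
    then show "parity_colouring P \<in> ?F"
      using P by (auto simp: H_partitions_def count_parity_colouring in_parity_colouring)
  qed
  finally show ?thesis .
qed

text \<open>Trades with even halves leave the odd parts alone and so keep them distinct. In a
  survivor the even parts are distinct as well and none is a multiple of 4. Its odd parts contribute
  the sign \<open>(- 1) ^ n\<close>, its even parts the sign in \<open>K\<close>.\<close>

lemma sum_sign_H_partitions: "(\<Sum>P\<in>H_partitions n. (- 1) ^ size P) = (- 1) ^ n * K n"
proof -
  let ?B = "{k::nat. 0 < k \<and> even k}"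
  let ?F = "{P \<in> H_partitions n. \<forall>k\<in>?B. 2 * k \<notin># P \<and> count P k \<le> 1}"
  have "(\<Sum>P\<in>H_partitions n. (- 1) ^ size P) = (\<Sum>P\<in>?F. (- 1 :: int) ^ size P)"
  proof (rule sum_cancel_trades[where c = "\<lambda>k. k"])
    show "finite (H_partitions n)" using finite_partitions by (simp add: H_partitions_def)
    fix Q and k :: nat assume "k \<in> ?B"
    then show "Q + {#2 * k#} \<in> H_partitions n \<longleftrightarrow> Q + {#k, k#} \<in> H_partitions n"
      by (auto simp: H_partitions_def partitions_def split: if_splits)
  qed (auto simp: inj_def)
  also have "?F = K_partitions n"
  proof (intro equalityI subsetI)
    fix P assume P: "P \<in> ?F"
    have "count P k \<le> 1" for k
    proof (cases "k \<in># P")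
      case True
      then have "0 < k" using P by (auto simp: H_partitions_def partitions_def)
      then show ?thesis using P by (cases "even k") (auto simp: H_partitions_def)
    qed (simp add: not_in_iff[THEN iffD1])
    \<comment> \<open>Otherwise \<open>k\<close> is a multiple of 4, and splitting it into two even
      halves is a possible trade.\<close>
    moreover have "k mod 4 = 2" if k: "k \<in># P" "even k" for k
    proof (rule ccontr)
      assume "k mod 4 \<noteq> 2"
      moreover have "0 < k" using P k by (auto simp: H_partitions_def partitions_def)
      ultimately have half: "k = 2 * (k div 2)" "even (k div 2)" "0 < k div 2"
        using k(2) by presburger+
      then have "2 * (k div 2) \<notin># P" using P by blast
      then show False using k(1) half(1) by simp
    qed
    ultimately show "P \<in> K_partitions n" using P by (auto simp: K_partitions_def H_partitions_def)
  next
    fix P assume P: "P \<in> K_partitions n"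
    have "2 * k \<notin># P" if "even k" for k
    proof
      assume "2 * k \<in># P"
      then have "2 * k mod 4 = 2" using P by (auto simp: K_partitions_def)
      then show False using that by presburger
    qed
    then show "P \<in> ?F" using P by (auto simp: K_partitions_def H_partitions_def)
  qed
  also have "(\<Sum>P\<in>K_partitions n. (- 1) ^ size P) = (- 1) ^ n * K n"
    unfolding K_def sum_distrib_left
  proof (rule sum.cong)
    fix P assume "P \<in> K_partitions n"
    then have "(\<Sum>k \<in># P. k) = n" by (simp add: K_partitions_def partitions_def)
    moreover have "size P = size {#k \<in># P. odd k#} + size {#k \<in># P. even k#}"
      by (induction P) auto
    ultimately show "(- 1 :: int) ^ size P = (- 1) ^ n * (- 1) ^ size {#k \<in># P. even k#}"
      using power_minus_one_size_odd[of "\<lambda>k. k" P] by (simp add: power_add)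
  qed simp
  finally show ?thesis .
qed

section \<open>From signed sums to the counts by parity\<close>

lemma card_parity:
  assumes "finite A" "(\<Sum>x\<in>A. (- 1) ^ g x) = d"
  shows "real (card {x \<in> A. even (g x)}) = 1 / 2 * (real (card A) + real_of_int d)"
    and "real (card {x \<in> A. odd (g x)}) = 1 / 2 * (real (card A) - real_of_int d)"
proof -
  have A: "A = {x \<in> A. even (g x)} \<union> {x \<in> A. odd (g x)}" by auto
  have "card A = card {x \<in> A. even (g x)} + card {x \<in> A. odd (g x)}"
    using assms(1) by (subst A, subst card_Un_disjoint) auto
  moreover have "(\<Sum>x\<in>A. (- 1 :: int) ^ g x) =
      int (card {x \<in> A. even (g x)}) - int (card {x \<in> A. odd (g x)})"
    using assms(1) by (subst A, subst sum.union_disjoint) auto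
  ultimately show "real (card {x \<in> A. even (g x)}) = 1 / 2 * (real (card A) + real_of_int d)"
    and "real (card {x \<in> A. odd (g x)}) = 1 / 2 * (real (card A) - real_of_int d)"
    using assms(2) by auto
qed

theorem theorem1p5:
  fixes n :: nat
  shows "real (G0 n) = 1 / 2 * (real (G n) + real (H n))
    \<and> real (G1 n) = 1 / 2 * (real (G n) - real (H n))
    \<and> real (G2 n) = 1 / 2 * (real (G n) + (- 1) ^ n * real (H n))
    \<and> real (G3 n) = 1 / 2 * (real (G n) - (- 1) ^ n * real (H n))
    \<and> real (G4 n) = 1 / 2 * (real (G n) + (- 1) ^ n * real_of_int (K n))
    \<and> real (G5 n) = 1 / 2 * (real (G n) - (- 1) ^ n * real_of_int (K n))"
proof -
  have "(\<Sum>P\<in>G_partitions n. (- 1 :: int) ^ size (blue_even_parts P))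
      = (\<Sum>P\<in>H_partitions n. (- 1) ^ size (blue_even_parts (parity_colouring P)))"
    \<comment> \<open>Splitting a blue \<open>2 * k\<close> changes the number of blue even parts by
      one: it rises if \<open>k\<close> is even and falls if \<open>k\<close> is odd.\<close>
    by (rule sum_G_partitions) (simp add: blue_even_parts_def)
  also have "\<dots> = (\<Sum>P\<in>H_partitions n. 1 :: int)"
  proof (rule sum.cong)
    fix P
    have "blue_even_parts (parity_colouring P) = {#}"
      by (auto simp: blue_even_parts_def parity_colouring_def filter_mset_eq_conv split: if_splits)
    then show "(- 1 :: int) ^ size (blue_even_parts (parity_colouring P)) = 1" by simp
  qed simp
  also have "\<dots> = int (H n)" by (simp add: H_def H_partitions_def)
  finally have even_parts: "(\<Sum>P\<in>G_partitions n. (- 1) ^ size (blue_even_parts P)) = int (H n)" .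

  have "(\<Sum>P\<in>G_partitions n. (- 1 :: int) ^ size (blue_parts P))
      = (\<Sum>P\<in>H_partitions n. (- 1) ^ size (blue_parts (parity_colouring P)))"
    by (rule sum_G_partitions) (simp add: blue_parts_def)
  also have "\<dots> = (\<Sum>P\<in>H_partitions n. (- 1) ^ n)"
  proof (rule sum.cong)
    fix P assume "P \<in> H_partitions n"
    then have "(\<Sum>k \<in># P. k) = n" by (simp add: H_partitions_def partitions_def)
    \<comment> \<open>Blue now means odd, and the number of odd parts has the parity of
      \<open>n\<close>.\<close>
    moreover have "size (blue_parts (parity_colouring P)) = size {#k \<in># P. odd k#}"
      unfolding blue_parts_def parity_colouring_def by (induction P) auto
    ultimately show "(- 1 :: int) ^ size (blue_parts (parity_colouring P)) = (- 1) ^ n"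
      using power_minus_one_size_odd[of "\<lambda>k. k" P] by simp
  qed simp
  also have "\<dots> = (- 1) ^ n * int (H n)" by (simp add: H_def H_partitions_def)
  finally have blue: "(\<Sum>P\<in>G_partitions n. (- 1) ^ size (blue_parts P)) = (- 1) ^ n * int (H n)" .

  have "(\<Sum>P\<in>G_partitions n. (- 1 :: int) ^ size P)
      = (\<Sum>P\<in>H_partitions n. (- 1) ^ size (parity_colouring P))"
    by (rule sum_G_partitions) simp
  then have all: "(\<Sum>P\<in>G_partitions n. (- 1) ^ size P) = (- 1) ^ n * K n"
    by (simp add: parity_colouring_def sum_sign_H_partitions)

  show ?thesis
    using card_parity[OF finite_G_partitions even_parts]
      card_parity[OF finite_G_partitions blue] card_parity[OF finite_G_partitions all]
    by (simp add: G_def G0_def G1_def G2_def G3_def G4_def G5_def)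
qed

end
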